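(* Let $|\mathcal U|\ge4$, let $\mathcal D\subseteq\mathcal R^{dich}$ be a domain satisfying (R5), and let $f\colon\mathcal D^N\to\mathcal R^{vNM}$ be an Arrovian social welfare function (with range $\mathcal R^{vNM}$). Then $f$ is affine utilitarian with positive weights, i.e., there are $w_1,\dots,w_n\in\mathbb R$ with $w_i>0$ for all $i\in N$ such that for all $R=(\succ_1,\dots,\succ_n)\in\mathcal D^N$ and all $(\phi_i)_{i\in N}\in\Phi^N$ with ${\succ_i}\equiv\phi_i$ for all $i\in N$, $f(R)\equiv\sum_{i\in N}w_i\phi_i$.
   Context: Outcomes. $\mathcal U$ is a non-empty finite set of alternatives; $\Delta$ is the set of all probability measures on $\mathcal U$. Each $a\in\mathcal U$ is identified with the point mass on $a$. For $X\subseteq\mathcal U$, $\Delta_X=\{p\in\Delta: p(X)=1\}$. Preferences. A preference relation is an asymmetric binary relation $\succ$ on $\Delta$; $p\sim q$ means neither $p\succ q$ nor $q\succ p$; $p\succsim q$ means $p\succ q$ or $p\sim q$. For a set $X$ of outcomes, ${\succ}|_X=\{(p,q)\in{\succ}: p,q\in X\}$. $\mathcal R^{vNM}$ is the set of preference relations $\succ$ for which there is a linear function $u\colon\Delta\to\mathbb R$ (i.e. $u(p)=\sum_{a\in\mathcal U}p(a)u(a)$) with $p\succ q\Leftrightarrow u(p)>u(q)$ for all $p,q\in\Delta$. $\mathcal R^{dich}$ is the set of those ${\succ}\in\mathcal R^{vNM}$ for which $u$ can be chosen with $u(a)\in\{0,1\}$ for all $a\in\mathcal U$ (this includes the empty relation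 $\emptyset$, complete indifference). SSB functions. An SSB function is a map $\phi\colon\Delta\times\Delta\to\mathbb R$ with $\phi(p,q)=-\phi(q,p)$ that is linear (i.e. preserves convex combinations) in each argument; it represents $\succ$ (written ${\succ}\equiv\phi$) if $p\succ q\Leftrightarrow\phi(p,q)>0$ for all $p,q\in\Delta$. Representing SSB functions are unique up to multiplication by a positive scalar; a relation in $\mathcal R^{vNM}$ with utility $u$ is represented by $\phi(p,q)=u(p)-u(q)$. $\Phi$ is the set of SSB functions whose largest value is $1$, together with the zero function (which represents $\emptyset$). Social welfare functions. $N=\{1,\dots,n\}$ with $n\ge2$ is the set of agents. A profile is $R=(\succ_1,\dots,\succ_n)\in\mathcal D^N$; restrictions $R|_X$ are componentwise. A social welfare function (SWF) with range $\mathcal R^{vNM}$ is a map $f\colon\mathcal D^N\to\mathcal R^{vNM}$. It satisfies Pareto optimality if for all $p,q\in\Delta$, $R\in\mathcal D^N$ and ${\succ}=f(R)$: $p\succsim_iq$ for all $i\in N$ implies $p\succsim q$, and if additionally $p\succ_iq$ for some $i$ then $p\succ q$. It satisfies IIA if for all $R,\hat R\in\mathcal D^N$ and $X\subseteq\mathcal U$: $R|_{\Delta_X}=\hat R|_{\Delta_X}$ implies $f(R)|_{\Delta_X}=f(\hat R)|_{\Delta_X}$. It is Arrovian if it satisfies Pareto optimality and IIA. Domain condition (R5): for all ${\hat\succ}\in\mathcal R^{dich}$ and all $X\subseteq\mathcal U$ with $|X|\le4$ there is ${\succ}\in\mathcal D$ such that ${\succ}|_X={\hat\succ}|_X$ (restriction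 to the pure outcomes in $X$). *)

theory Defs
  imports "HOL-Probability.Probability_Mass_Function"
begin

text \<open>
  The set of alternatives is the universe of a finite type \<open>'a\<close>, so every probability
  measure on it is given by a unique \<open>'a pmf\<close>. An alternative \<open>a\<close> is identified with
  \<open>return_pmf a\<close>.
\<close>

definition lotteries_on :: "'a set \<Rightarrow> 'a pmf set" where
  "lotteries_on X = {p. measure_pmf.prob p X = 1}"

definition mix_pmf :: "real \<Rightarrow> 'a pmf \<Rightarrow> 'a pmf \<Rightarrow> 'a pmf" where
  "mix_pmf t p q = bind_pmf (bernoulli_pmf t) (\<lambda>b. if b then p else q)"

text \<open>
  \<open>mix_pmf t p q\<close> is the convex combination of \<open>p\<close> and \<open>q\<close>. The side condition is needed
  because \<open>bernoulli_pmf\<close> truncates its argument to the unit interval.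
\<close>

lemma pmf_mix_pmf:
  assumes "t \<in> {0..1}"
  shows "pmf (mix_pmf t p q) a = t * pmf p a + (1 - t) * pmf q a"
  using assms by (simp add: mix_pmf_def pmf_bind)

subsection \<open>Preference relations\<close>

text \<open>\<open>(p, q) \<in> r\<close> means that \<open>p\<close> is strictly preferred to \<open>q\<close>.\<close>

type_synonym 'a pref = "'a pmf rel"

definition is_pref :: "'a pref \<Rightarrow> bool" where
  "is_pref r \<longleftrightarrow> asym r"

definition indiff :: "'a pref \<Rightarrow> 'a pmf \<Rightarrow> 'a pmf \<Rightarrow> bool" where
  "indiff r p q \<longleftrightarrow> (p, q) \<notin> r \<and> (q, p) \<notin> r"

definition weakly_prefers :: "'a pref \<Rightarrow> 'a pmf \<Rightarrow> 'a pmf \<Rightarrow> bool" where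
  "weakly_prefers r p q \<longleftrightarrow> (p, q) \<in> r \<or> indiff r p q"

definition linear_utility :: "('a::finite pmf \<Rightarrow> real) \<Rightarrow> bool" where
  "linear_utility u \<longleftrightarrow> (\<forall>p. u p = (\<Sum>a\<in>UNIV. pmf p a * u (return_pmf a)))"

definition utility_represents :: "('a pmf \<Rightarrow> real) \<Rightarrow> 'a pref \<Rightarrow> bool" where
  "utility_represents u r \<longleftrightarrow> (\<forall>p q. (p, q) \<in> r \<longleftrightarrow> u p > u q)"

definition vNM :: "'a::finite pref set" where
  "vNM = {r. is_pref r \<and> (\<exists>u. linear_utility u \<and> utility_represents u r)}"

definition dich :: "'a::finite pref set" where
  "dich = {r \<in> vNM. \<exists>u. linear_utility u \<and> utility_represents u r \<and>
                         (\<forall>a. u (return_pmf a) \<in> {0, 1})}"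

subsection \<open>SSB functions\<close>

definition preserves_mixtures :: "('a pmf \<Rightarrow> real) \<Rightarrow> bool" where
  "preserves_mixtures g \<longleftrightarrow>
     (\<forall>t\<in>{0..1}. \<forall>p q. g (mix_pmf t p q) = t * g p + (1 - t) * g q)"

definition SSB :: "('a pmf \<Rightarrow> 'a pmf \<Rightarrow> real) \<Rightarrow> bool" where
  "SSB \<phi> \<longleftrightarrow> (\<forall>p q. \<phi> p q = - \<phi> q p) \<and>
             (\<forall>q. preserves_mixtures (\<lambda>p. \<phi> p q)) \<and>
             (\<forall>p. preserves_mixtures (\<lambda>q. \<phi> p q))"

definition represents :: "('a pmf \<Rightarrow> 'a pmf \<Rightarrow> real) \<Rightarrow> 'a pref \<Rightarrow> bool" where
  "represents \<phi> r \<longleftrightarrow> (\<forall>p q. (p, q) \<in> r \<longleftrightarrow> \<phi> p q > 0)"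

definition normalized_SSB :: "('a pmf \<Rightarrow> 'a pmf \<Rightarrow> real) set" where
  "normalized_SSB = {\<phi>. SSB \<phi> \<and>
     (((\<forall>p q. \<phi> p q \<le> 1) \<and> (\<exists>p q. \<phi> p q = 1)) \<or> \<phi> = (\<lambda>p q. 0))}"

subsection \<open>Social welfare functions\<close>

text \<open>
  The agents are \<open>1, \<dots>, n\<close>. The extensional function space makes a profile determined by
  its values on the agents.
\<close>

definition profiles :: "nat \<Rightarrow> 'a pref set \<Rightarrow> (nat \<Rightarrow> 'a pref) set" where
  "profiles n D = {1..n} \<rightarrow>\<^sub>E D"

definition SWF :: "nat \<Rightarrow> 'a::finite pref set \<Rightarrow> ((nat \<Rightarrow> 'a pref) \<Rightarrow> 'a pref) \<Rightarrow> bool" where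
  "SWF n D f \<longleftrightarrow> f \<in> profiles n D \<rightarrow> vNM"

definition pareto_optimal ::
    "nat \<Rightarrow> 'a pref set \<Rightarrow> ((nat \<Rightarrow> 'a pref) \<Rightarrow> 'a pref) \<Rightarrow> bool" where
  "pareto_optimal n D f \<longleftrightarrow>
     (\<forall>R\<in>profiles n D. \<forall>p q. (\<forall>i\<in>{1..n}. weakly_prefers (R i) p q) \<longrightarrow>
        weakly_prefers (f R) p q \<and>
        ((\<exists>i\<in>{1..n}. (p, q) \<in> R i) \<longrightarrow> (p, q) \<in> f R))"

definition IIA ::
    "nat \<Rightarrow> 'a pref set \<Rightarrow> ((nat \<Rightarrow> 'a pref) \<Rightarrow> 'a pref) \<Rightarrow> bool" where
  "IIA n D f \<longleftrightarrow>
     (\<forall>R\<in>profiles n D. \<forall>R'\<in>profiles n D. \<forall>X.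
        (\<forall>i\<in>{1..n}. Restr (R i) (lotteries_on X) = Restr (R' i) (lotteries_on X)) \<longrightarrow>
        Restr (f R) (lotteries_on X) = Restr (f R') (lotteries_on X))"

definition arrovian ::
    "nat \<Rightarrow> 'a pref set \<Rightarrow> ((nat \<Rightarrow> 'a pref) \<Rightarrow> 'a pref) \<Rightarrow> bool" where
  "arrovian n D f \<longleftrightarrow> pareto_optimal n D f \<and> IIA n D f"

text \<open>Domain richness; here relations are restricted to the pure outcomes in \<open>X\<close> only.\<close>

definition R5 :: "'a::finite pref set \<Rightarrow> bool" where
  "R5 D \<longleftrightarrow>
     (\<forall>r'\<in>dich. \<forall>X. card X \<le> 4 \<longrightarrow>
        (\<exists>r\<in>D. Restr r (return_pmf ` X) = Restr r' (return_pmf ` X)))"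

end

theory Submission
  imports Defs
begin

text \<open>
  Every dichotomous relation is given by a set of approved alternatives, so on a set of at most
  four alternatives a profile may be prescribed by the coalition \<open>\<sigma> x\<close> approving each \<open>x\<close>.
  For a coalition \<open>S\<close>, let \<open>v S\<close> be the relative position of \<open>a\<close> on the social utility scale
  from \<open>c\<close> to \<open>b\<close> when \<open>a\<close> is approved by \<open>S\<close>, \<open>b\<close> by everybody and \<open>c\<close> by nobody.
  Cloning one of the three alternatives by a fourth one, which is Pareto indifferent to it, shows
  with IIA that \<open>v S\<close> does not depend on \<open>(a, b, c)\<close>. Comparing with unanimously approved and
  disapproved alternatives, the social utility of any triple is then a positive affine
  transformation of \<open>v \<circ> \<sigma>\<close>, and hence so is the social utility on all alternatives.
  Pareto indifference between \<open>(a + b) / 2\<close> and \<open>(c + d) / 2\<close>, where \<open>a, b, c, d\<close> are approved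
  by \<open>S\<close>, \<open>T\<close>, \<open>S \<union> T\<close> and \<open>{}\<close> with \<open>S\<close> and \<open>T\<close> disjoint, makes \<open>v\<close> additive.
\<close>

section \<open>Expected utility\<close>

definition expect :: "('a::finite \<Rightarrow> real) \<Rightarrow> 'a pmf \<Rightarrow> real" where
  "expect g p = (\<Sum>a\<in>UNIV. pmf p a * g a)"

text \<open>Every relation in \<open>vNM\<close> or \<open>dich\<close> has this form, so the later
  arguments deal with real functions on alternatives instead of linear functions on
  lotteries.\<close>

definition pref_of :: "('a::finite \<Rightarrow> real) \<Rightarrow> 'a pref" where
  "pref_of g = {(p, q). expect g p > expect g q}"

lemma mem_pref_of [simp]: "(p, q) \<in> pref_of g \<longleftrightarrow> expect g p > expect g q"
  by (simp add: pref_of_def)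

lemma expect_return [simp]: "expect g (return_pmf a) = g a"
proof -
  have "expect g (return_pmf a) = (\<Sum>x\<in>UNIV. if x = a then g x else 0)"
    unfolding expect_def by (rule sum.cong) (auto simp: indicator_def)
  then show ?thesis by simp
qed

lemma expect_mix:
  assumes "t \<in> {0..1}"
  shows "expect g (mix_pmf t p q) = t * expect g p + (1 - t) * expect g q"
  using assms
  by (simp add: expect_def pmf_mix_pmf algebra_simps sum.distrib sum_distrib_left sum_subtractf)

lemma sum_pmf_UNIV: "(\<Sum>a\<in>UNIV. pmf (p :: 'a::finite pmf) a) = 1"
  by (simp add: sum_pmf_eq_1)

lemma mem_lotteries_on: "p \<in> lotteries_on X \<longleftrightarrow> (\<forall>a. a \<notin> X \<longrightarrow> pmf p a = 0)"
proof -
  have "p \<in> lotteries_on X \<longleftrightarrow> set_pmf p \<subseteq> X"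
    unfolding lotteries_on_def
    by (simp add: measure_pmf.prob_eq_1 AE_measure_pmf_iff subset_iff Ball_def)
  then show ?thesis by (auto simp: set_pmf_iff)
qed

lemma lotteries_on_mono: "X \<subseteq> Y \<Longrightarrow> lotteries_on X \<subseteq> lotteries_on Y"
  by (meson mem_lotteries_on subsetD subsetI)

lemma return_in_lotteries_on: "a \<in> X \<Longrightarrow> return_pmf a \<in> lotteries_on X"
  by (auto simp: mem_lotteries_on indicator_def)

lemma mix_in_lotteries_on:
  assumes "t \<in> {0..1}" "p \<in> lotteries_on X" "q \<in> lotteries_on X"
  shows "mix_pmf t p q \<in> lotteries_on X"
  using assms by (simp add: mem_lotteries_on pmf_mix_pmf)

text \<open>Outside \<open>X\<close> the weights of \<open>p\<close> vanish, and they sum to 1,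
  which turns \<open>\<beta>\<close> into the constant term.\<close>

lemma expect_affine_on:
  fixes p :: "'a::finite pmf"
  assumes "p \<in> lotteries_on X" and "\<forall>x\<in>X. g x = \<alpha> * h x + \<beta>"
  shows "expect g p = \<alpha> * expect h p + \<beta>"
proof -
  have "expect g p = (\<Sum>a\<in>UNIV. \<alpha> * (pmf p a * h a) + \<beta> * pmf p a)"
    unfolding expect_def
  proof (rule sum.cong)
    fix x
    show "pmf p x * g x = \<alpha> * (pmf p x * h x) + \<beta> * pmf p x"
      using assms by (cases "x \<in> X") (auto simp: mem_lotteries_on algebra_simps)
  qed simp
  also have "\<dots> = \<alpha> * expect h p + \<beta> * (\<Sum>a\<in>UNIV. pmf p a)"
    by (simp add: sum.distrib sum_distrib_left expect_def)
  finally show ?thesis by (simp add: sum_pmf_UNIV)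
qed

lemma expect_sum:
  "expect (\<lambda>x. \<Sum>i\<in>I. w i * g i x) p = (\<Sum>i\<in>I. w i * expect (g i) p)"
proof -
  have "expect (\<lambda>x. \<Sum>i\<in>I. w i * g i x) p = (\<Sum>a\<in>UNIV. \<Sum>i\<in>I. w i * (pmf p a * g i a))"
    by (simp add: expect_def sum_distrib_left algebra_simps)
  also have "\<dots> = (\<Sum>i\<in>I. w i * expect (g i) p)"
    by (subst sum.swap) (simp add: expect_def sum_distrib_left)
  finally show ?thesis .
qed

section \<open>Positive affine equivalence\<close>

definition aff :: "'a set \<Rightarrow> ('a \<Rightarrow> real) \<Rightarrow> ('a \<Rightarrow> real) \<Rightarrow> bool" where
  "aff X g h \<longleftrightarrow> (\<exists>\<alpha>>0. \<exists>\<beta>. \<forall>x\<in>X. g x = \<alpha> * h x + \<beta>)"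

lemma aff_subset: "aff X g h \<Longrightarrow> Y \<subseteq> X \<Longrightarrow> aff Y g h"
  unfolding aff_def by blast

lemma aff_trans:
  assumes "aff X g h" "aff X h k" shows "aff X g k"
proof -
  obtain \<alpha> \<beta> \<gamma> \<delta> where "\<alpha> > 0" "\<gamma> > 0"
    "\<forall>x\<in>X. g x = \<alpha> * h x + \<beta>" "\<forall>x\<in>X. h x = \<gamma> * k x + \<delta>"
    using assms unfolding aff_def by blast
  then have "\<alpha> * \<gamma> > 0" "\<forall>x\<in>X. g x = (\<alpha> * \<gamma>) * k x + (\<alpha> * \<delta> + \<beta>)"
    by (auto simp: algebra_simps)
  then show ?thesis unfolding aff_def by blast
qed

text \<open>All the triples share \<open>d\<close>. If some \<open>x\<close> has \<open>h x\<close>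
  different from \<open>h d\<close>, then \<open>x\<close> and \<open>d\<close> alone determine both
  coefficients, so every triple containing them uses the same ones. If \<open>h\<close> is constant,
  so is \<open>g\<close>, and a shift suffices.\<close>

lemma aff_glue:
  assumes "\<And>x y. x \<in> X \<Longrightarrow> y \<in> X \<Longrightarrow> aff {x, y, d} g h"
  shows "aff (insert d X) g h"
proof (cases "\<forall>x\<in>X. h x = h d")
  case True
  have "g x = 1 * h x + (g d - h d)" if "x \<in> insert d X" for x
  proof (cases "x \<in> X")
    case True
    then have "h x = h d" using \<open>\<forall>x\<in>X. h x = h d\<close> by blast
    moreover obtain \<alpha> \<beta> where "g x = \<alpha> * h x + \<beta>" "g d = \<alpha> * h d + \<beta>"
      using assms[OF True True] unfolding aff_def by blast
    ultimately show ?thesis by simp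
  next
    case False
    then show ?thesis using that by simp
  qed
  then show ?thesis unfolding aff_def using zero_less_one by blast
next
  case False
  then obtain x where x: "x \<in> X" "h x \<noteq> h d" by blast
  then obtain \<alpha> \<beta> where ab: "\<alpha> > 0" "g x = \<alpha> * h x + \<beta>" "g d = \<alpha> * h d + \<beta>"
    using assms[OF x(1) x(1)] unfolding aff_def by blast
  have "g y = \<alpha> * h y + \<beta>" if y: "y \<in> X" for y
  proof -
    obtain \<gamma> \<delta> where cd: "g x = \<gamma> * h x + \<delta>" "g d = \<gamma> * h d + \<delta>" "g y = \<gamma> * h y + \<delta>"
      using assms[OF x(1) y] unfolding aff_def by blast
    have "(\<alpha> - \<gamma>) * (h x - h d) = 0"
      using ab cd by (simp add: algebra_simps)
    then have "\<gamma> = \<alpha>" using x by simp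
    then show ?thesis using ab cd by simp
  qed
  then show ?thesis unfolding aff_def using ab by blast
qed

text \<open>Uniqueness of von Neumann-Morgenstern utility: each \<open>b\<close> is indifferent to a
  mixture of an \<open>h\<close>-best and an \<open>h\<close>-worst alternative of \<open>X\<close>,
  and the same mixture must be indifferent to \<open>b\<close> under \<open>g\<close>.\<close>

lemma Restr_pref_of_imp_aff:
  fixes g h :: "'a::finite \<Rightarrow> real"
  assumes "Restr (pref_of g) (lotteries_on X) = Restr (pref_of h) (lotteries_on X)"
  shows "aff X g h"
proof -
  have iff: "expect g p > expect g q \<longleftrightarrow> expect h p > expect h q"
    if "p \<in> lotteries_on X" "q \<in> lotteries_on X" for p q
    using assms that by (auto simp: set_eq_iff)
  have pure: "g x > g y \<longleftrightarrow> h x > h y" if "x \<in> X" "y \<in> X" for x y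
    using iff[OF return_in_lotteries_on return_in_lotteries_on, OF that] by simp
  show ?thesis
  proof (cases "\<exists>x\<in>X. \<exists>y\<in>X. h x \<noteq> h y")
    case False
    have const: "h x = h y \<and> g x = g y" if "x \<in> X" "y \<in> X" for x y
    proof -
      have "h x = h y" using False that by blast
      then show ?thesis using pure[OF that] pure[OF that(2,1)] by simp
    qed
    \<comment> \<open>\<open>SOME\<close> fixes one reference point of \<open>X\<close>; for empty
      \<open>X\<close> the claim is vacuous.\<close>
    have "g x = 1 * h x + (g (SOME y. y \<in> X) - h (SOME y. y \<in> X))" if "x \<in> X" for x
      using const[OF that someI[of "\<lambda>y. y \<in> X", OF that]] by simp
    then show ?thesis unfolding aff_def using zero_less_one by blast
  next
    case True
    then have "X \<noteq> {}" by blast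
    have "Max (h ` X) \<in> h ` X" "Min (h ` X) \<in> h ` X"
      using \<open>X \<noteq> {}\<close> by (auto intro!: Max_in Min_in)
    then obtain a c where "a \<in> X" "h a = Max (h ` X)" and "c \<in> X" "h c = Min (h ` X)"
      by fastforce
    then have a: "a \<in> X" "\<forall>x\<in>X. h x \<le> h a" and c: "c \<in> X" "\<forall>x\<in>X. h c \<le> h x"
      by auto
    have ac: "h a > h c" using True a c by (meson order_antisym order_trans not_le)
    then have gac: "g a > g c" using pure a c by blast
    define \<alpha> where "\<alpha> = (g a - g c) / (h a - h c)"
    have "g b = \<alpha> * h b + (g c - \<alpha> * h c)" if b: "b \<in> X" for b
    proof -
      \<comment> \<open>The weight on \<open>a\<close> at which the mixture of \<open>a\<close> and
        \<open>c\<close> has the same \<open>h\<close>-utility as \<open>b\<close>.\<close>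
      define t where "t = (h b - h c) / (h a - h c)"
      have t: "t \<in> {0..1}" using ac a c b by (auto simp: t_def field_simps)
      let ?m = "mix_pmf t (return_pmf a) (return_pmf c)"
      have m: "?m \<in> lotteries_on X"
        using t a c by (intro mix_in_lotteries_on return_in_lotteries_on)
      have tb: "t * (h a - h c) = h b - h c" using ac by (simp add: t_def)
      have "expect h ?m = h b" using tb by (simp add: expect_mix[OF t] algebra_simps)
      then have "expect g ?m = g b"
        using iff[OF m return_in_lotteries_on[OF b]] iff[OF return_in_lotteries_on[OF b] m]
        by simp
      then have "g b = t * (g a - g c) + g c" by (simp add: expect_mix[OF t] algebra_simps)
      then show ?thesis by (simp add: \<alpha>_def t_def diff_divide_distrib algebra_simps)
    qed
    moreover have "\<alpha> > 0" using ac gac by (simp add: \<alpha>_def)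
    ultimately show ?thesis unfolding aff_def by blast
  qed
qed

lemma aff_imp_pref_of_eq:
  assumes "aff UNIV g h" shows "pref_of g = pref_of h"
proof -
  obtain \<alpha> \<beta> where ab: "\<alpha> > 0" "\<forall>x\<in>UNIV. g x = \<alpha> * h x + \<beta>"
    using assms unfolding aff_def by blast
  have "expect g p = \<alpha> * expect h p + \<beta>" for p
    using expect_affine_on[OF _ ab(2)] by (simp add: mem_lotteries_on)
  then show ?thesis using ab(1) by (auto simp: pref_of_def)
qed

section \<open>Approval sets\<close>

abbreviation approval :: "'a::finite set \<Rightarrow> 'a pref" where
  "approval A \<equiv> pref_of (indicat_real A)"

lemma utility_represents_expect:
  "utility_represents (expect g) r \<Longrightarrow> r = pref_of g"
  by (auto simp: utility_represents_def)

lemma linear_utility_eq_expect: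
  "linear_utility u \<Longrightarrow> u = expect (\<lambda>a. u (return_pmf a))"
  unfolding linear_utility_def expect_def by (intro ext) blast

lemma vNM_imp_pref_of:
  assumes "r \<in> vNM" shows "\<exists>g. r = pref_of g"
proof -
  obtain u where u: "linear_utility u" "utility_represents u r"
    using assms by (auto simp: vNM_def)
  have "r = pref_of (\<lambda>a. u (return_pmf a))"
    by (rule utility_represents_expect)
       (use u(2) in \<open>simp only: linear_utility_eq_expect[OF u(1), symmetric]\<close>)
  then show ?thesis by blast
qed

lemma dich_imp_approval:
  assumes "r \<in> dich" shows "\<exists>A. r = approval A"
proof -
  obtain u where u: "linear_utility u" "utility_represents u r" "\<forall>a. u (return_pmf a) \<in> {0, 1}"
    using assms by (auto simp: dich_def)
  let ?A = "{a. u (return_pmf a) = 1}"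
  have "(\<lambda>a. u (return_pmf a)) = indicat_real ?A"
    using u(3) by (auto simp: indicator_def fun_eq_iff)
  then have "expect (indicat_real ?A) = u"
    using linear_utility_eq_expect[OF u(1)] by (simp only:)
  then have "r = approval ?A"
    by (intro utility_represents_expect) (simp only: u(2))
  then show ?thesis by blast
qed

lemma approval_in_dich: "approval A \<in> dich"
proof -
  have "linear_utility (expect (indicat_real A))"
    unfolding linear_utility_def by (simp add: expect_def[symmetric])
  moreover have "utility_represents (expect (indicat_real A)) (approval A)"
    by (simp add: utility_represents_def)
  moreover have "is_pref (approval A)" by (auto simp: is_pref_def asym_on_def)
  ultimately show ?thesis
    unfolding dich_def vNM_def by (auto simp: indicator_def intro!: exI[of _ "expect (indicat_real A)"])
qed

text \<open>Domain richness controls pure outcomes only; this lifts it to lotteries. A difference of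
  two 0-1 values is determined by its sign, so comparing every \<open>x\<close> with a fixed
  \<open>c\<close> shows that the two indicators differ by a constant on \<open>X\<close>.\<close>

lemma Restr_approval_pure_imp:
  fixes A B :: "'a::finite set"
  assumes "Restr (approval A) (return_pmf ` X) = Restr (approval B) (return_pmf ` X)"
  shows "Restr (approval A) (lotteries_on X) = Restr (approval B) (lotteries_on X)"
proof (cases "X = {}")
  case True
  then show ?thesis
    using set_pmf_not_empty by (fastforce simp: mem_lotteries_on set_pmf_eq)
next
  case False
  then obtain c where c: "c \<in> X" by blast
  have "indicat_real A x > indicat_real A y \<longleftrightarrow> indicat_real B x > indicat_real B y"
    if "x \<in> X" "y \<in> X" for x y
  proof -
    have "(return_pmf x, return_pmf y) \<in> Restr (approval A) (return_pmf ` X) \<longleftrightarrow>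
          (return_pmf x, return_pmf y) \<in> Restr (approval B) (return_pmf ` X)"
      using assms by simp
    then show ?thesis using that by simp
  qed
  from this[OF _ c] this[OF c]
  have "\<forall>x\<in>X. indicat_real A x = 1 * indicat_real B x + (indicat_real A c - indicat_real B c)"
    by (auto simp: indicator_def split: if_splits)
  then have "expect (indicat_real A) p = expect (indicat_real B) p + (indicat_real A c - indicat_real B c)"
    if "p \<in> lotteries_on X" for p
    using expect_affine_on[OF that, of "indicat_real A" 1 "indicat_real B"] by simp
  then show ?thesis by auto
qed

lemma Restr_approval_cong:
  assumes "A \<inter> X = B \<inter> X"
  shows "Restr (approval A) (lotteries_on X) = Restr (approval B) (lotteries_on X)"
proof (rule Restr_approval_pure_imp)
  show "Restr (approval A) (return_pmf ` X) = Restr (approval B) (return_pmf ` X)"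
    using assms by (auto simp: indicator_def split: if_splits)
qed

lemma expect_indicator_bounds: "expect (indicat_real A) p \<in> {0..1}"
proof -
  have "expect (indicat_real A) p \<le> (\<Sum>a\<in>UNIV. pmf p a)"
    unfolding expect_def by (rule sum_mono) (simp add: indicator_def)
  moreover have "expect (indicat_real A) p \<ge> 0"
    unfolding expect_def by (rule sum_nonneg) (simp add: indicator_def)
  ultimately show ?thesis by (simp add: sum_pmf_UNIV)
qed

text \<open>Bilinearity and skew-symmetry make \<open>\<phi> p q\<close> depend only on the two
  utilities. Replacing both lotteries by mixtures of an approved \<open>a\<close> and a disapproved
  \<open>b\<close> leaves a multiple of \<open>\<phi>\<close> at \<open>(a, b)\<close>, and the
  normalization makes that value 1.\<close>

lemma normalized_SSB_approval:
  assumes norm: "\<phi> \<in> normalized_SSB" and rep: "represents \<phi> (approval A)"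
  shows "\<phi> p q = expect (indicat_real A) p - expect (indicat_real A) q"
proof -
  let ?u = "expect (indicat_real A)"
  have pos: "\<phi> p q > 0 \<longleftrightarrow> ?u p > ?u q" for p q
    using rep by (simp add: represents_def)
  have SSB: "SSB \<phi>" using norm unfolding normalized_SSB_def by blast
  then have skew: "\<phi> p q = - \<phi> q p" for p q
    unfolding SSB_def by blast
  have lin1: "\<phi> (mix_pmf t p p') q = t * \<phi> p q + (1 - t) * \<phi> p' q"
    and lin2: "\<phi> q (mix_pmf t p p') = t * \<phi> q p + (1 - t) * \<phi> q p'"
    if "t \<in> {0..1}" for t p p' q
    using SSB that unfolding SSB_def preserves_mixtures_def by blast+
  have zero: "\<phi> p q = 0" if "?u p = ?u q" for p q
    using pos[of p q] pos[of q p] skew[of p q] that by linarith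
  have half: "(1/2::real) \<in> {0..1}" by simp
  have cong: "\<phi> p q = \<phi> p' q" if "?u p = ?u p'" for p p' q
  proof -
    \<comment> \<open>Both mixtures have the same utility. Expanding the left side, the terms for
      \<open>(p, p')\<close> and \<open>(q, q)\<close> vanish too, leaving \<open>\<phi> p q\<close>
      and \<open>\<phi> q p'\<close>.\<close>
    have "\<phi> (mix_pmf (1/2) p q) (mix_pmf (1/2) p' q) = 0"
      by (rule zero) (simp add: expect_mix[OF half] that)
    then have "\<phi> p p' + \<phi> p q + \<phi> q p' + \<phi> q q = 0"
      by (simp add: lin1[OF half] lin2[OF half] field_simps)
    then show ?thesis using zero[of p p'] zero[of q q] skew[of q p'] that by simp
  qed
  show ?thesis
  proof (cases "A = {} \<or> A = UNIV")
    case True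
    then have "?u p = ?u q" by (auto simp: expect_def sum_pmf_UNIV)
    then show ?thesis using zero by simp
  next
    case False
    then obtain a b where ab: "a \<in> A" "b \<notin> A" by blast
    let ?a = "return_pmf a" and ?b = "return_pmf b"
    have eq: "\<phi> p q = (?u p - ?u q) * \<phi> ?a ?b" for p q
    proof -
      \<comment> \<open>As \<open>a\<close> has utility 1 and \<open>b\<close> has utility 0, the
        weight on \<open>a\<close> is the utility of the mixture.\<close>
      define P Q where "P = mix_pmf (?u p) ?a ?b" and "Q = mix_pmf (?u q) ?a ?b"
      have "?u P = ?u p" "?u Q = ?u q"
        unfolding P_def Q_def using ab by (simp_all add: expect_mix[OF expect_indicator_bounds])
      then have "\<phi> p q = \<phi> P Q" using cong[of p P q] cong[of q Q P] skew by metis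
      also have "\<dots> = (?u p - ?u q) * \<phi> ?a ?b"
        unfolding P_def Q_def
        using zero[of ?a ?a] zero[of ?b ?b] skew[of ?b ?a]
        by (simp add: lin1[OF expect_indicator_bounds] lin2[OF expect_indicator_bounds])
           (simp add: algebra_simps)
      finally show ?thesis .
    qed
    have c: "\<phi> ?a ?b > 0" using pos[of ?a ?b] ab by simp
    then have "\<phi> \<noteq> (\<lambda>p q. 0)" by auto
    then obtain P Q where PQ: "\<phi> P Q = 1" and le: "\<phi> ?a ?b \<le> 1"
      using norm by (auto simp: normalized_SSB_def)
    \<comment> \<open>With \<open>\<phi> P Q = 1\<close> this forces the value at
      \<open>(a, b)\<close> to be at least 1; \<open>le\<close> bounds it from above.\<close>
    have "?u P - ?u Q \<le> 1"
      using expect_indicator_bounds[of A P] expect_indicator_bounds[of A Q] by simp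
    then have "(?u P - ?u Q) * \<phi> ?a ?b \<le> 1 * \<phi> ?a ?b"
      using c by (intro mult_right_mono) auto
    then have "\<phi> ?a ?b = 1" using PQ le eq[of P Q] by simp
    then show ?thesis using eq[of p q] by simp
  qed
qed

section \<open>Arrovian social welfare functions on dichotomous domains\<close>

lemma ex_outside_three:
  assumes "card (UNIV :: 'a::finite set) \<ge> 4"
  shows "\<exists>d :: 'a. d \<notin> {x, y, z}"
proof (rule ccontr)
  assume "\<not> ?thesis"
  then have "UNIV = {x, y, z}" by blast
  moreover have "card {x, y, z} \<le> 3"
    by (simp add: card_insert_if)
  ultimately show False using assms by simp
qed

lemma ex_distinct_four:
  assumes "card (UNIV :: 'a::finite set) \<ge> 4"
  obtains a b c d :: "'a::finite" where "distinct [a, b, c, d]"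
proof -
  fix a :: 'a
  obtain b where "b \<notin> {a, a, a}" using ex_outside_three[OF assms] by blast
  moreover obtain c where "c \<notin> {a, a, b}" using ex_outside_three[OF assms] by blast
  moreover obtain d where "d \<notin> {a, b, c}" using ex_outside_three[OF assms] by blast
  ultimately show ?thesis using that[of a b c d] by auto
qed

text \<open>A fourth alternative serves as a spare place: three single replacements swap two
  neighbouring entries (\<open>sw12\<close>, \<open>sw23\<close>). The entries \<open>x\<close>,
  \<open>y\<close>, \<open>z\<close> of the goal are then brought into their places one after the
  other.\<close>

lemma distinct_triples_connected:
  fixes P :: "'a::finite \<Rightarrow> 'a \<Rightarrow> 'a \<Rightarrow> bool"
  assumes card: "card (UNIV :: 'a set) \<ge> 4"
    and base: "P a b c" "distinct [a, b, c]"
    and s1: "\<And>x y z d. P x y z \<Longrightarrow> distinct [x, y, z, d] \<Longrightarrow> P d y z"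
    and s2: "\<And>x y z d. P x y z \<Longrightarrow> distinct [x, y, z, d] \<Longrightarrow> P x d z"
    and s3: "\<And>x y z d. P x y z \<Longrightarrow> distinct [x, y, z, d] \<Longrightarrow> P x y d"
    and goal: "distinct [x, y, z]"
  shows "P x y z"
proof -
  have sw12: "P y x z" if "P x y z" "distinct [x, y, z]" for x y z
  proof -
    obtain d where d: "d \<notin> {x, y, z}" using ex_outside_three[OF card] by blast
    have "P d y z" using s1[OF that(1), of d] that d by auto
    then have "P d x z" using s2[of d y z x] that d by auto
    then show ?thesis using s1[of d x z y] that d by auto
  qed
  have sw23: "P x z y" if "P x y z" "distinct [x, y, z]" for x y z
  proof -
    obtain d where d: "d \<notin> {x, y, z}" using ex_outside_three[OF card] by blast
    have "P x d z" using s2[OF that(1), of d] that d by auto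
    then have "P x d y" using s3[of x d z y] that d by auto
    then show ?thesis using s2[of x d y z] that d by auto
  qed
  have "\<exists>b' c'. P x b' c' \<and> distinct [x, b', c']"
  proof -
    consider "x = a" | "x = b" | "x = c" | "x \<notin> {a, b, c}" by blast
    then show ?thesis
    proof cases
      case 1 then show ?thesis using base by blast
    next
      case 2 then show ?thesis using sw12[OF base] base(2) by auto
    next
      case 3
      have "P a c b" using sw23[OF base] .
      then have "P c a b" using sw12[of a c b] base(2) by auto
      then show ?thesis using 3 base(2) by auto
    next
      case 4 then show ?thesis using s1[OF base(1), of x] base(2) by auto
    qed
  qed
  then obtain b' c' where 1: "P x b' c'" "distinct [x, b', c']" by blast
  have "\<exists>c''. P x y c'' \<and> distinct [x, y, c'']"
  proof -
    consider "y = b'" | "y = c'" | "y \<notin> {x, b', c'}" using goal by auto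
    then show ?thesis
    proof cases
      case 1 then show ?thesis using \<open>P x b' c'\<close> \<open>distinct [x, b', c']\<close> by blast
    next
      case 2 then show ?thesis using sw23[OF 1] 1(2) by auto
    next
      case 3 then show ?thesis using s2[OF 1(1), of y] 1(2) by auto
    qed
  qed
  then obtain c'' where 2: "P x y c''" "distinct [x, y, c'']" by blast
  then show ?thesis using s3[OF 2(1), of z] goal by (cases "z = c''") auto
qed

section \<open>Profiles prescribed by approving coalitions\<close>

locale arrovian_dichotomous =
  fixes n :: nat
    and D :: "'a::finite pref set"
    and f :: "(nat \<Rightarrow> 'a pref) \<Rightarrow> 'a pref"
  assumes n: "n \<ge> 1"
    and card4: "card (UNIV :: 'a set) \<ge> 4"
    and D_dich: "D \<subseteq> dich"
    and rich: "R5 D"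
    and swf: "SWF n D f"
    and arr: "arrovian n D f"
begin

text \<open>Only the restriction to \<open>X\<close> is prescribed, which is all that richness can
  provide and all that IIA looks at. Since approving all of \<open>X\<close> and approving none of
  it give the same restriction, \<open>R\<close> does not determine \<open>\<sigma>\<close>.\<close>

definition realizes :: "(nat \<Rightarrow> 'a pref) \<Rightarrow> 'a set \<Rightarrow> ('a \<Rightarrow> nat set) \<Rightarrow> bool" where
  "realizes R X \<sigma> \<longleftrightarrow> R \<in> profiles n D \<and>
     (\<forall>i\<in>{1..n}. Restr (R i) (lotteries_on X) = Restr (approval {x. i \<in> \<sigma> x}) (lotteries_on X))"

lemma realizes_subset:
  assumes "realizes R X \<sigma>" "Y \<subseteq> X" shows "realizes R Y \<sigma>"
proof -
  have "Restr r (lotteries_on Y) = Restr (Restr r (lotteries_on X)) (lotteries_on Y)"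
    for r :: "'a pref"
    using lotteries_on_mono[OF assms(2)] by auto
  then show ?thesis using assms(1) unfolding realizes_def by metis
qed

lemma realizes_cong:
  assumes "realizes R X \<sigma>" "\<And>x. x \<in> X \<Longrightarrow> \<sigma> x = \<tau> x" shows "realizes R X \<tau>"
proof -
  have "Restr (approval {x. i \<in> \<sigma> x}) (lotteries_on X) =
        Restr (approval {x. i \<in> \<tau> x}) (lotteries_on X)" for i
    by (rule Restr_approval_cong) (use assms(2) in auto)
  then show ?thesis using assms(1) unfolding realizes_def by simp
qed

text \<open>Richness is applied to each agent separately and lifted from pure outcomes to lotteries;
  no condition links the choices of different agents.\<close>

lemma realizes_exists:
  assumes "card X \<le> 4" shows "\<exists>R. realizes R X \<sigma>"
proof -
  have "\<exists>r. r \<in> D \<and> Restr r (lotteries_on X) = Restr (approval {x. i \<in> \<sigma> x}) (lotteries_on X)" for i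
  proof -
    obtain r where r: "r \<in> D"
      "Restr r (return_pmf ` X) = Restr (approval {x. i \<in> \<sigma> x}) (return_pmf ` X)"
      using rich assms approval_in_dich unfolding R5_def by blast
    then obtain A where "r = approval A" using D_dich dich_imp_approval by blast
    then show ?thesis using r Restr_approval_pure_imp by blast
  qed
  then obtain r where r: "\<forall>i. r i \<in> D \<and>
      Restr (r i) (lotteries_on X) = Restr (approval {x. i \<in> \<sigma> x}) (lotteries_on X)"
    using choice[of "\<lambda>i r. r \<in> D \<and>
      Restr r (lotteries_on X) = Restr (approval {x. i \<in> \<sigma> x}) (lotteries_on X)"] by blast
  then have "realizes (restrict r {1..n}) X \<sigma>"
    unfolding realizes_def profiles_def by simp
  then show ?thesis by blast
qed

lemma realizes_social:
  assumes "realizes R X \<sigma>" shows "\<exists>g. f R = pref_of g"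
  using assms swf vNM_imp_pref_of unfolding realizes_def SWF_def by blast

lemma realizes_exists_social:
  assumes "card X \<le> 4" shows "\<exists>R g. realizes R X \<sigma> \<and> f R = pref_of g"
  using realizes_exists[OF assms] realizes_social by blast

text \<open>By IIA both profiles give the same social preference over lotteries on \<open>X\<close>,
  and utility is unique up to positive affine transformations.\<close>

lemma realizes_aff:
  assumes "realizes R X \<sigma>" "realizes R' X \<sigma>" "f R = pref_of g" "f R' = pref_of g'"
  shows "aff X g g'"
proof (rule Restr_pref_of_imp_aff)
  have "IIA n D f" using arr by (simp add: arrovian_def)
  then have "Restr (f R) (lotteries_on X) = Restr (f R') (lotteries_on X)"
    using assms(1,2) unfolding IIA_def realizes_def by metis
  then show "Restr (pref_of g) (lotteries_on X) = Restr (pref_of g') (lotteries_on X)"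
    using assms(3,4) by simp
qed

lemma realizes_pareto:
  assumes R: "realizes R X \<sigma>" "f R = pref_of g"
    and pq: "p \<in> lotteries_on X" "q \<in> lotteries_on X"
    and ge: "\<And>i. i \<in> {1..n} \<Longrightarrow>
      expect (indicat_real {x. i \<in> \<sigma> x}) p \<ge> expect (indicat_real {x. i \<in> \<sigma> x}) q"
  shows "expect g p \<ge> expect g q"
    and "(\<exists>i\<in>{1..n}. expect (indicat_real {x. i \<in> \<sigma> x}) p > expect (indicat_real {x. i \<in> \<sigma> x}) q)
      \<Longrightarrow> expect g p > expect g q"
proof -
  have eq: "(r, s) \<in> R i \<longleftrightarrow> (r, s) \<in> approval {x. i \<in> \<sigma> x}"
    if "i \<in> {1..n}" "r \<in> lotteries_on X" "s \<in> lotteries_on X" for i r s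
    using R(1) that unfolding realizes_def by blast
  have "\<forall>i\<in>{1..n}. weakly_prefers (R i) p q"
    using ge eq pq by (force simp: weakly_prefers_def indiff_def)
  moreover have "pareto_optimal n D f" "R \<in> profiles n D"
    using arr R(1) by (auto simp: arrovian_def realizes_def)
  ultimately have "weakly_prefers (f R) p q \<and> ((\<exists>i\<in>{1..n}. (p, q) \<in> R i) \<longrightarrow> (p, q) \<in> f R)"
    unfolding pareto_optimal_def by blast
  then show "expect g p \<ge> expect g q"
    "(\<exists>i\<in>{1..n}. expect (indicat_real {x. i \<in> \<sigma> x}) p > expect (indicat_real {x. i \<in> \<sigma> x}) q)
      \<Longrightarrow> expect g p > expect g q"
    using R(2) eq pq by (auto simp: weakly_prefers_def indiff_def)
qed

text \<open>Every agent is indifferent between \<open>x\<close> and \<open>y\<close>, so Pareto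
  applies in both directions.\<close>

lemma realizes_eq:
  assumes R: "realizes R X \<sigma>" "f R = pref_of g" and xy: "x \<in> X" "y \<in> X" "\<sigma> x = \<sigma> y"
  shows "g x = g y"
  using realizes_pareto(1)[OF R return_in_lotteries_on[OF xy(1)] return_in_lotteries_on[OF xy(2)]]
    realizes_pareto(1)[OF R return_in_lotteries_on[OF xy(2)] return_in_lotteries_on[OF xy(1)]] xy(3)
  by (simp add: indicator_def)

lemma realizes_less:
  assumes R: "realizes R X \<sigma>" "f R = pref_of g" and xy: "x \<in> X" "y \<in> X"
    and S: "\<sigma> y = {}" "\<sigma> x \<noteq> {}" "\<sigma> x \<subseteq> {1..n}"
  shows "g y < g x"
proof -
  obtain i where "i \<in> \<sigma> x" "i \<in> {1..n}" using S by blast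
  then show ?thesis
    using realizes_pareto(2)[OF R return_in_lotteries_on[OF xy(1)] return_in_lotteries_on[OF xy(2)]] S
    by (force simp: indicator_def)
qed

section \<open>The relative position of an alternative approved by a coalition\<close>

definition position :: "nat set \<Rightarrow> 'a \<Rightarrow> 'a \<Rightarrow> 'a \<Rightarrow> real \<Rightarrow> bool" where
  "position S x y z t \<longleftrightarrow> (\<forall>R \<sigma> g. realizes R {x, y, z} \<sigma> \<longrightarrow> f R = pref_of g \<longrightarrow>
     \<sigma> x = S \<longrightarrow> \<sigma> y = {1..n} \<longrightarrow> \<sigma> z = {} \<longrightarrow> g x - g z = t * (g y - g z))"

text \<open>A profile realizing \<open>\<tau>\<close> on \<open>X\<close> contains both triples, and
  corresponding entries have the same approvers, hence equal social utility. This carries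
  \<open>t\<close> to the second triple, and \<open>realizes_aff\<close> extends it to all other
  profiles there.\<close>

lemma position_clone:
  assumes pos: "position S x y z t" and dist: "distinct [x, y, z]" "distinct [x', y', z']"
    and sub: "{x, y, z, x', y', z'} \<subseteq> X" "card X \<le> 4"
    and \<tau>: "\<tau> x = S" "\<tau> y = {1..n}" "\<tau> z = {}" "\<tau> x' = S" "\<tau> y' = {1..n}" "\<tau> z' = {}"
  shows "position S x' y' z' t"
  unfolding position_def
proof (intro allI impI)
  fix R \<sigma> g
  assume R: "realizes R {x', y', z'} \<sigma>" "f R = pref_of g"
    and \<sigma>: "\<sigma> x' = S" "\<sigma> y' = {1..n}" "\<sigma> z' = {}"
  obtain R' g' where R': "realizes R' X \<tau>" "f R' = pref_of g'"
    using realizes_exists_social[OF sub(2)] by blast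
  have "realizes R' {x', y', z'} \<sigma>"
    by (rule realizes_cong[OF realizes_subset[OF R'(1)]]) (use sub \<sigma> \<tau> in auto)
  then have "aff {x', y', z'} g g'" using realizes_aff R R' by blast
  then obtain \<alpha> \<beta> where ab: "g x' = \<alpha> * g' x' + \<beta>" "g y' = \<alpha> * g' y' + \<beta>" "g z' = \<alpha> * g' z' + \<beta>"
    unfolding aff_def by auto
  have "realizes R' {x, y, z} \<tau>" using realizes_subset[OF R'(1)] sub by auto
  then have "g' x - g' z = t * (g' y - g' z)"
    using pos R'(2) \<tau> unfolding position_def by blast
  moreover have "g' x = g' x'" "g' y = g' y'" "g' z = g' z'"
    using realizes_eq[OF R'] sub \<tau> by auto
  ultimately have "g' x' - g' z' = t * (g' y' - g' z')" by simp
  moreover have "g x' - g z' = \<alpha> * (g' x' - g' z')" "g y' - g z' = \<alpha> * (g' y' - g' z')"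
    by (simp_all add: ab algebra_simps)
  ultimately show "g x' - g z' = t * (g y' - g z')" by simp
qed

lemma card_four: "card {x, y, z, d} \<le> 4"
  by (simp add: card_insert_if)

lemma position_exists:
  "\<exists>t. \<forall>x y z. distinct [x, y, z] \<longrightarrow> position S x y z t"
proof -
  obtain a b c d :: 'a where "distinct [a, b, c, d]"
    using ex_distinct_four[OF card4] by blast
  then have abc: "distinct [a, b, c]" by simp
  define \<rho> where "\<rho> = (\<lambda>x. if x = a then S else if x = b then {1..n} else {})"
  obtain R g where R: "realizes R {a, b, c} \<rho>" "f R = pref_of g"
    using realizes_exists_social[of "{a, b, c}" \<rho>] card_four[of a a b c] by auto
  \<comment> \<open>As \<open>n \<ge> 1\<close>, the coalition of all agents is nonempty, so the
    scale from \<open>c\<close> to \<open>b\<close> has positive length.\<close>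
  have bc: "g b > g c"
    using realizes_less[OF R, of b c] abc n by (auto simp: \<rho>_def)
  define t where "t = (g a - g c) / (g b - g c)"
  have base: "position S a b c t"
    unfolding position_def
  proof (intro allI impI)
    fix R' \<sigma> g'
    assume R': "realizes R' {a, b, c} \<sigma>" "f R' = pref_of g'"
      and \<sigma>: "\<sigma> a = S" "\<sigma> b = {1..n}" "\<sigma> c = {}"
    have "realizes R' {a, b, c} \<rho>"
      by (rule realizes_cong[OF R'(1)]) (use \<sigma> abc in \<open>auto simp: \<rho>_def\<close>)
    then have "aff {a, b, c} g' g" using realizes_aff R R' by blast
    then obtain \<alpha> \<beta> where ab: "g' a = \<alpha> * g a + \<beta>" "g' b = \<alpha> * g b + \<beta>" "g' c = \<alpha> * g c + \<beta>"
      unfolding aff_def by auto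
    have "g a - g c = t * (g b - g c)" using bc by (simp add: t_def)
    moreover have "g' a - g' c = \<alpha> * (g a - g c)" "g' b - g' c = \<alpha> * (g b - g c)"
      by (simp_all add: ab algebra_simps)
    ultimately show "g' a - g' c = t * (g' b - g' c)" by simp
  qed
  have "position S x y z t" if dist: "distinct [x, y, z]" for x y z
  proof (rule distinct_triples_connected[where P = "\<lambda>x y z. position S x y z t",
        OF card4 base abc _ _ _ dist])
    \<comment> \<open>In each case \<open>\<tau>\<close> gives \<open>d\<close> the same approvers
      as the entry it replaces.\<close>
    fix x y z d
    assume P: "position S x y z t" and dist: "distinct [x, y, z, d]"
    show "position S d y z t"
      by (rule position_clone[OF P, where X = "{x, y, z, d}"
            and \<tau> = "\<lambda>u. if u = y then {1..n} else if u = z then {} else S"])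
         (use dist card_four in auto)
    show "position S x d z t"
      by (rule position_clone[OF P, where X = "{x, y, z, d}"
            and \<tau> = "\<lambda>u. if u = x then S else if u = z then {} else {1..n}"])
         (use dist card_four in auto)
    show "position S x y d t"
      by (rule position_clone[OF P, where X = "{x, y, z, d}"
            and \<tau> = "\<lambda>u. if u = x then S else if u = y then {1..n} else {}"])
         (use dist card_four in auto)
  qed
  then show ?thesis by blast
qed

section \<open>The value of a coalition\<close>

definition val :: "nat set \<Rightarrow> real" where
  "val S = (SOME t. \<forall>x y z. distinct [x, y, z] \<longrightarrow> position S x y z t)"

lemma position_val:
  assumes "distinct [x, y, z]" shows "position S x y z (val S)"
  using someI_ex[OF position_exists[of S]] assms unfolding val_def by blast

lemma realizes_val:
  assumes R: "realizes R X \<sigma>" "f R = pref_of g" and X: "{x, y, z} \<subseteq> X" "distinct [x, y, z]"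
    and \<sigma>: "\<sigma> y = {1..n}" "\<sigma> z = {}"
  shows "g x - g z = val (\<sigma> x) * (g y - g z)"
  using position_val[OF X(2)] realizes_subset[OF R(1) X(1)] R(2) \<sigma>
  unfolding position_def by blast

text \<open>Supplies a profile whose scale from \<open>z\<close> to \<open>y\<close> is
  nondegenerate, so that facts about \<open>g x\<close> and \<open>g z\<close> can be solved for
  \<open>val S\<close>.\<close>

lemma val_scale:
  obtains R X \<sigma> g x y z where "realizes R X \<sigma>" "f R = pref_of g" "x \<in> X" "z \<in> X"
    "\<sigma> x = S" "\<sigma> z = {}" "g x - g z = val S * (g y - g z)" "g y > g z"
proof -
  obtain x y z d :: 'a where "distinct [x, y, z, d]"
    using ex_distinct_four[OF card4] by blast
  then have dist: "distinct [x, y, z]" by simp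
  let ?\<sigma> = "\<lambda>u. if u = x then S else if u = y then {1..n} else {}"
  obtain R g where R: "realizes R {x, y, z} ?\<sigma>" "f R = pref_of g"
    using realizes_exists_social[of "{x, y, z}" ?\<sigma>] card_four[of x x y z] by auto
  show ?thesis
  proof (rule that[OF R, of x z y])
    show "g x - g z = val S * (g y - g z)"
      using realizes_val[OF R, of x y z] dist by (auto simp del: One_nat_def)
    show "g y > g z" using realizes_less[OF R, of y z] dist n by auto
  qed (use dist in auto)
qed

lemma val_empty: "val {} = 0"
proof -
  obtain R X \<sigma> g x y z where *: "realizes R X \<sigma>" "f R = pref_of g" "x \<in> X" "z \<in> X"
    "\<sigma> x = {}" "\<sigma> z = {}" "g x - g z = val {} * (g y - g z)" "g y > g z"
    by (rule val_scale)
  then have "g x = g z" using realizes_eq[OF *(1-4)] by simp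
  then show ?thesis using * by simp
qed

lemma val_pos:
  assumes "S \<noteq> {}" "S \<subseteq> {1..n}" shows "val S > 0"
proof -
  obtain R X \<sigma> g x y z where *: "realizes R X \<sigma>" "f R = pref_of g" "x \<in> X" "z \<in> X"
    "\<sigma> x = S" "\<sigma> z = {}" "g x - g z = val S * (g y - g z)" "g y > g z"
    by (rule val_scale)
  then have "val S * (g y - g z) > 0" using realizes_less[OF *(1-4)] assms by simp
  then show ?thesis using *(8) by (simp add: zero_less_mult_iff)
qed

section \<open>Social utility as an affine image of the value\<close>

text \<open>The alternative \<open>z\<close> is the bottom of the scale, and a fresh
  \<open>d\<close> approved by everybody supplies its top. By IIA, adding \<open>d\<close> does not
  affect the social preference on the triple.\<close>

lemma realizes_aff_val_disapproved:
  assumes R: "realizes R X \<sigma>" "f R = pref_of g" and X: "{x, y, z} \<subseteq> X"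
    and \<sigma>: "\<sigma> z = {}"
  shows "aff {x, y, z} g (\<lambda>x. val (\<sigma> x))"
proof -
  obtain d where d: "d \<notin> {x, y, z}" using ex_outside_three[OF card4] by blast
  let ?\<tau> = "\<sigma>(d := {1..n})"
  obtain R' g' where R': "realizes R' {x, y, z, d} ?\<tau>" "f R' = pref_of g'"
    using realizes_exists_social[OF card_four] by blast
  have "realizes R' {x, y, z} \<sigma>"
    by (rule realizes_cong[OF realizes_subset[OF R'(1)]]) (use d in auto)
  then have "aff {x, y, z} g g'"
    using realizes_aff realizes_subset[OF R(1) X] R(2) R'(2) by blast
  moreover have "aff {x, y, z} g' (\<lambda>x. val (\<sigma> x))"
  proof -
    have pos: "g' d - g' z > 0"
      using realizes_less[OF R', of d z] d \<sigma> n by auto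
    \<comment> \<open>The case \<open>u = z\<close> is separate because \<open>realizes_val\<close>
      speaks of three distinct alternatives.\<close>
    have "g' u = (g' d - g' z) * val (\<sigma> u) + g' z" if u: "u \<in> {x, y, z}" for u
    proof (cases "u = z")
      case True then show ?thesis using \<sigma> val_empty by simp
    next
      case False
      then have "g' u - g' z = val (?\<tau> u) * (g' d - g' z)"
        by (intro realizes_val[OF R']) (use u d \<sigma> in auto)
      moreover have "?\<tau> u = \<sigma> u" using u d by auto
      ultimately show ?thesis by (simp add: algebra_simps)
    qed
    then show ?thesis unfolding aff_def using pos by blast
  qed
  ultimately show ?thesis by (rule aff_trans)
qed

text \<open>For an arbitrary triple a fresh \<open>d\<close> approved by nobody is added. The
  triples through \<open>d\<close> are covered by the previous lemma and glued along
  \<open>d\<close>; IIA returns to the original profile, and a second gluing covers all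
  alternatives.\<close>

lemma realizes_aff_val:
  assumes R: "realizes R UNIV \<sigma>" "f R = pref_of g"
  shows "aff UNIV g (\<lambda>x. val (\<sigma> x))"
proof -
  have triple: "aff {x, y, z} g (\<lambda>x. val (\<sigma> x))" for x y z
  proof -
    obtain d where d: "d \<notin> {x, y, z}" using ex_outside_three[OF card4] by blast
    let ?\<tau> = "\<sigma>(d := {})"
    obtain R' g' where R': "realizes R' {x, y, z, d} ?\<tau>" "f R' = pref_of g'"
      using realizes_exists_social[OF card_four] by blast
    have "realizes R' {x, y, z} \<sigma>"
      by (rule realizes_cong[OF realizes_subset[OF R'(1)]]) (use d in auto)
    then have gg': "aff {x, y, z} g g'"
      using realizes_aff realizes_subset[OF R(1)] R(2) R'(2) by blast
    have "aff (insert d {x, y, z}) g' (\<lambda>x. val (?\<tau> x))"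
      by (rule aff_glue, rule realizes_aff_val_disapproved[OF R']) auto
    then have "aff {x, y, z} g' (\<lambda>x. val (?\<tau> x))" by (rule aff_subset) auto
    moreover have "\<forall>u\<in>{x, y, z}. ?\<tau> u = \<sigma> u" using d by auto
    ultimately have "aff {x, y, z} g' (\<lambda>x. val (\<sigma> x))" unfolding aff_def by metis
    then show ?thesis by (rule aff_trans[OF gg'])
  qed
  \<comment> \<open>Any alternative can serve as the common point here; \<open>undefined\<close> is
    just one of them.\<close>
  have "aff (insert undefined UNIV) g (\<lambda>x. val (\<sigma> x))" by (rule aff_glue) (rule triple)
  then show ?thesis by simp
qed

section \<open>Additivity of the value\<close>

lemma val_disjoint_union:
  assumes "S \<inter> T = {}" shows "val (S \<union> T) = val S + val T"
proof -
  obtain a b c d :: 'a where dist: "distinct [a, b, c, d]"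
    using ex_distinct_four[OF card4] by blast
  let ?X = "{a, b, c, d}"
  define \<sigma> where "\<sigma> = (\<lambda>x. if x = a then S else if x = b then T else if x = c then S \<union> T else {})"
  have \<sigma>: "\<sigma> a = S" "\<sigma> b = T" "\<sigma> c = S \<union> T" "\<sigma> d = {}"
    using dist by (auto simp: \<sigma>_def)
  obtain R g where R: "realizes R ?X \<sigma>" "f R = pref_of g"
    using realizes_exists_social[OF card_four] by blast
  have half: "(1/2::real) \<in> {0..1}" by simp
  let ?p = "mix_pmf (1/2) (return_pmf a) (return_pmf b)"
  let ?q = "mix_pmf (1/2) (return_pmf c) (return_pmf d)"
  have pq: "?p \<in> lotteries_on ?X" "?q \<in> lotteries_on ?X"
    by (intro mix_in_lotteries_on return_in_lotteries_on; simp)+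
  \<comment> \<open>An agent in \<open>S\<close> or \<open>T\<close> is in exactly one of them and
    gets 1/2 from both lotteries; any other agent gets 0 from both.\<close>
  have "expect (indicat_real {x. i \<in> \<sigma> x}) ?p = expect (indicat_real {x. i \<in> \<sigma> x}) ?q" for i
    using assms by (auto simp: expect_mix[OF half] \<sigma> indicator_def)
  then have "expect g ?p = expect g ?q"
    using realizes_pareto(1)[OF R pq] realizes_pareto(1)[OF R pq(2,1)] by (simp add: order_antisym)
  then have sum: "g a + g b = g c + g d" by (simp add: expect_mix[OF half])
  \<comment> \<open>Nobody approves \<open>d\<close>, so it can be the common point. In the balance
    \<open>sum\<close> each side then carries \<open>\<beta>\<close> twice, and \<open>d\<close>
    contributes value 0.\<close>
  have "aff (insert d {a, b, c}) g (\<lambda>x. val (\<sigma> x))"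
    by (rule aff_glue, rule realizes_aff_val_disapproved[OF R]) (auto simp: \<sigma>)
  then obtain \<alpha> \<beta> where "\<alpha> > 0" "\<forall>x\<in>insert d {a, b, c}. g x = \<alpha> * val (\<sigma> x) + \<beta>"
    unfolding aff_def by blast
  then have "\<alpha> > 0" "\<alpha> * (val S + val T) = \<alpha> * val (S \<union> T)"
    using sum by (auto simp: \<sigma> val_empty algebra_simps)
  then show ?thesis by simp
qed

lemma val_sum:
  assumes "finite S" shows "val S = (\<Sum>i\<in>S. val {i})"
  using assms
proof (induction S rule: finite_induct)
  case empty
  then show ?case by (simp add: val_empty)
next
  case (insert i S)
  then show ?case using val_disjoint_union[of "{i}" S] by simp
qed

section \<open>Weighted approval and the utilitarian representation\<close>

text \<open>With \<open>\<sigma> x\<close> the set of approvers of \<open>x\<close>, the profile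
  realizes \<open>\<sigma>\<close> on all alternatives, and additivity splits
  \<open>val (\<sigma> x)\<close> into the weights of the single approvers.\<close>

lemma social_eq:
  assumes R: "R \<in> profiles n D" and A: "\<And>i. i \<in> {1..n} \<Longrightarrow> R i = approval (A i)"
  shows "f R = pref_of (\<lambda>x. \<Sum>i\<in>{1..n}. val {i} * indicat_real (A i) x)"
proof -
  define \<sigma> where "\<sigma> = (\<lambda>x. {i \<in> {1..n}. x \<in> A i})"
  have "{x. i \<in> \<sigma> x} = A i" if "i \<in> {1..n}" for i
    using that by (auto simp: \<sigma>_def)
  then have real: "realizes R UNIV \<sigma>" using R A by (simp add: realizes_def)
  then obtain g where g: "f R = pref_of g" using realizes_social by blast
  have "val (\<sigma> x) = (\<Sum>i\<in>{1..n}. val {i} * indicat_real (A i) x)" for x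
  proof -
    have "val (\<sigma> x) = (\<Sum>i\<in>{1..n} \<inter> {i. x \<in> A i}. val {i})"
      by (subst val_sum) (auto simp: \<sigma>_def intro: sum.cong)
    also have "\<dots> = (\<Sum>i\<in>{1..n}. if x \<in> A i then val {i} else 0)"
      by (subst sum.inter_restrict) simp_all
    also have "\<dots> = (\<Sum>i\<in>{1..n}. val {i} * indicat_real (A i) x)"
      by (rule sum.cong) (auto simp: indicator_def)
    finally show ?thesis .
  qed
  then show ?thesis using aff_imp_pref_of_eq[OF realizes_aff_val[OF real g]] g by simp
qed

text \<open>Each \<open>\<phi> i\<close> is a difference of expected approval, so the weighted sum
  is the difference of expected social utility.\<close>

lemma affine_utilitarian:
  assumes R: "R \<in> profiles n D"
    and \<phi>: "\<And>i. i \<in> {1..n} \<Longrightarrow> \<phi> i \<in> normalized_SSB \<and> represents (\<phi> i) (R i)"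
  shows "represents (\<lambda>p q. \<Sum>i\<in>{1..n}. val {i} * \<phi> i p q) (f R)"
proof -
  have "\<exists>A. R i = approval A" if "i \<in> {1..n}" for i
    using R D_dich dich_imp_approval that unfolding profiles_def by blast
  then obtain A where A: "\<And>i. i \<in> {1..n} \<Longrightarrow> R i = approval (A i)" by metis
  have "\<phi> i p q = expect (indicat_real (A i)) p - expect (indicat_real (A i)) q"
    if "i \<in> {1..n}" for i p q
    using normalized_SSB_approval \<phi>[OF that] A[OF that] by metis
  then have "(\<Sum>i\<in>{1..n}. val {i} * \<phi> i p q) =
      expect (\<lambda>x. \<Sum>i\<in>{1..n}. val {i} * indicat_real (A i) x) p -
      expect (\<lambda>x. \<Sum>i\<in>{1..n}. val {i} * indicat_real (A i) x) q" for p q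
    by (simp only: expect_sum) (simp add: right_diff_distrib sum_subtractf)
  moreover have "f R = pref_of (\<lambda>x. \<Sum>i\<in>{1..n}. val {i} * indicat_real (A i) x)"
    using R A by (rule social_eq)
  ultimately show ?thesis
    unfolding represents_def by (simp only: mem_pref_of) simp
qed

end

theorem theorem4:
  fixes n :: nat
    and D :: "'a::finite pref set"
    and f :: "(nat \<Rightarrow> 'a pref) \<Rightarrow> 'a pref"
  assumes "n \<ge> 2"
    and "card (UNIV :: 'a set) \<ge> 4"
    and "D \<subseteq> dich"
    and "R5 D"
    and "SWF n D f"
    and "arrovian n D f"
  shows "\<exists>w :: nat \<Rightarrow> real. (\<forall>i\<in>{1..n}. w i > 0) \<and>
           (\<forall>R\<in>profiles n D. \<forall>\<phi>.
              (\<forall>i\<in>{1..n}. \<phi> i \<in> normalized_SSB \<and> represents (\<phi> i) (R i)) \<longrightarrow>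
              represents (\<lambda>p q. \<Sum>i\<in>{1..n}. w i * \<phi> i p q) (f R))"
proof -
  interpret arrovian_dichotomous n D f
    using assms by unfold_locales auto
  show ?thesis
    \<comment> \<open>The weight of an agent is the value of the coalition consisting of that agent
      alone, which is positive by Pareto optimality.\<close>
    using val_pos affine_utilitarian by (intro exI[of _ "\<lambda>i. val {i}"]) auto
qed

end
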